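(* There are combinatorial $(6,2)$-hypersimplices that are not $G$-generic.
   Context: For integers $0<k<n$, $\Delta_{n,k}=\mathrm{conv}\{x\in\{0,1\}^n : x_1+\cdots+x_n=k\}$. For $2\le k\le n-2$ its facets are exactly the $2n$ faces $F_i=\Delta_{n,k}\cap\{x_i=0\}\cong\Delta_{n-1,k}$ and $G_i=\Delta_{n,k}\cap\{x_i=1\}\cong\Delta_{n-1,k-1}$, $i=1,\dots,n$. A combinatorial $(n,k)$-hypersimplex is a polytope $P$ (regarded as full-dimensional in $\mathbb{R}^{n-1}$) together with an isomorphism of its face lattice with that of $\Delta_{n,k}$; the facets of $P$ corresponding to the $G_i$ are called its $G$-facets. $P$ is $G$-generic if the $n$ hyperplanes in $\mathbb{R}^{n-1}$ supporting the $G$-facets are not projectively concurrent, i.e. they have no common point and are not all parallel to a common line. *)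

theory Defs
  imports "HOL-Analysis.Analysis"
begin

text \<open>The ambient dimension \<open>n\<close> of the hypersimplex is \<open>CARD('n)\<close>.\<close>

definition hypersimplex :: "nat \<Rightarrow> (real ^ 'n) set" where
  "hypersimplex k =
     convex hull {x. (\<forall>i. x $ i \<in> {0, 1}) \<and> (\<Sum>i\<in>UNIV. x $ i) = real k}"

definition G_face :: "nat \<Rightarrow> 'n \<Rightarrow> (real ^ 'n) set" where
  "G_face k i = hypersimplex k \<inter> {x. x $ i = 1}"

text \<open>
  The faces in the sense of \<^const>\<open>face_of\<close> include the empty face and the polytope itself.
\<close>

definition face_lattice_iso ::
  "('a::real_vector set \<Rightarrow> 'b::real_vector set) \<Rightarrow> 'a set \<Rightarrow> 'b set \<Rightarrow> bool" where
  "face_lattice_iso \<phi> P Q \<longleftrightarrow>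
     bij_betw \<phi> {F. F face_of P} {F. F face_of Q} \<and>
     (\<forall>F F'. F face_of P \<longrightarrow> F' face_of P \<longrightarrow> (F \<subseteq> F' \<longleftrightarrow> \<phi> F \<subseteq> \<phi> F'))"

text \<open>
  A combinatorial \<open>(n, k)\<close>-hypersimplex is a pair \<open>(P, \<phi>)\<close>; the parameter \<open>n\<close> is read off
  from the type of \<open>\<phi>\<close>.
\<close>

definition combinatorial_hypersimplex ::
  "nat \<Rightarrow> 'a::euclidean_space set \<Rightarrow> ((real ^ 'n) set \<Rightarrow> 'a set) \<Rightarrow> bool" where
  "combinatorial_hypersimplex k P \<phi> \<longleftrightarrow>
     DIM('a) = CARD('n) - 1 \<and>
     polytope P \<and> aff_dim P = int DIM('a) \<and>
     face_lattice_iso \<phi> (hypersimplex k) P"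

definition projectively_concurrent :: "('i \<Rightarrow> 'a::real_vector set) \<Rightarrow> bool" where
  "projectively_concurrent H \<longleftrightarrow>
     (\<exists>p. \<forall>i. p \<in> H i) \<or>
     (\<exists>v. v \<noteq> 0 \<and> (\<forall>i. \<forall>x\<in>H i. \<forall>t. x + t *\<^sub>R v \<in> H i))"

text \<open>
  As \<open>P\<close> is full-dimensional, the only hyperplane supporting \<open>P\<close> in a given facet is the affine
  hull of that facet. The \<open>G\<close>-facets are facets when \<open>2 \<le> k \<le> n - 2\<close>.
\<close>

definition G_generic ::
  "nat \<Rightarrow> ((real ^ 'n) set \<Rightarrow> 'a::euclidean_space set) \<Rightarrow> bool" where
  "G_generic k \<phi> \<longleftrightarrow>
     \<not> projectively_concurrent (\<lambda>i. affine hull (\<phi> (G_face k i)))"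

end

theory Submission
  imports Defs
begin

text \<open>
  Let \<open>A\<close> be a matrix with diagonal \<open>-1\<close> and positive off-diagonal entries satisfying
  \<open>A\<^sub>i\<^sub>j A\<^sub>j\<^sub>i = 1\<close>. The hyperplane \<open>(A x)\<^sub>i = 0\<close> cuts the vertex \<open>e\<^sub>i\<close> off a simplex, and reciprocity says
  that the \<open>i\<close>-th and the \<open>j\<close>-th hyperplane meet the edge \<open>e\<^sub>i e\<^sub>j\<close> in the same point. Hence
  \<open>{x \<ge> 0, A x \<ge> 0, \<Sum>x = 2}\<close> has one vertex on each edge of the simplex, with incidences
  independent of \<open>A\<close>, and entries \<open>1\<close> off the diagonal give \<open>\<Delta>\<^sub>n\<^sub>,\<^sub>2\<close>. The \<open>G\<close>-hyperplanes are
  \<open>(A x)\<^sub>i = 0\<close>, so \<open>G\<close>-genericity fails as soon as \<open>A\<close> is singular; a kernel vector with coordinate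
  sum zero is a direction common to all of them. For \<open>n = 6\<close> a suitable circulant matrix
  annihilates \<open>(1, -1, 1, -1, 1, -1)\<close>.
\<close>

text \<open>All \<open>s i + t * d i\<close> then stay nonnegative for
  \<open>\<bar>t\<bar> \<le> e\<close>. An index with \<open>s i = 0\<close> imposes nothing, and
  finitely many positive bounds have a positive minimum.\<close>

lemma small_step:
  fixes s d :: "'i \<Rightarrow> real"
  assumes "finite I" "\<And>i. i \<in> I \<Longrightarrow> 0 \<le> s i" "\<And>i. i \<in> I \<Longrightarrow> s i = 0 \<Longrightarrow> d i = 0"
  obtains e where "0 < e" "\<And>i. i \<in> I \<Longrightarrow> e * \<bar>d i\<bar> \<le> s i"
proof -
  have "\<exists>e>0. \<forall>i\<in>I. e * \<bar>d i\<bar> \<le> s i"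
    using assms
  proof (induction I rule: finite_induct)
    case empty
    show ?case by (auto intro: exI[of _ 1])
  next
    case (insert k I)
    then obtain e where e: "0 < e" "\<forall>i\<in>I. e * \<bar>d i\<bar> \<le> s i" by auto
    obtain e' where e': "0 < e'" "e' * \<bar>d k\<bar> \<le> s k"
    proof (cases "s k = 0")
      case True
      then show ?thesis using that[of 1] insert.prems by simp
    next
      case False
      then have "0 < s k" using insert.prems(1)[of k] by simp
      then show ?thesis using that[of "s k / (1 + \<bar>d k\<bar>)"]
        by (simp add: field_simps add_pos_nonneg)
    qed
    have "min e e' * \<bar>d i\<bar> \<le> e * \<bar>d i\<bar>" "min e e' * \<bar>d i\<bar> \<le> e' * \<bar>d i\<bar>" for i
      by (simp_all add: mult_right_mono)
    then show ?case
      using e e' by (intro exI[of _ "min e e'"]) (auto intro: order_trans)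
  qed
  then show ?thesis using that by blast
qed

section \<open>Faces of a polyhedron given by affine inequalities\<close>

definition affine_map :: "('a::real_vector \<Rightarrow> 'b::real_vector) \<Rightarrow> bool" where
  "affine_map h \<longleftrightarrow>
     (\<forall>x y t. h ((1 - t) *\<^sub>R x + t *\<^sub>R y) = (1 - t) *\<^sub>R h x + t *\<^sub>R h y)"

text \<open>Taking \<open>S\<close> empty yields the polyhedron itself, so polyhedron and faces
  share one notation.\<close>

definition tight_set :: "'a::real_vector set \<Rightarrow> ('i \<Rightarrow> 'a \<Rightarrow> real) \<Rightarrow> 'i set \<Rightarrow> 'a set" where
  "tight_set A h S = {x\<in>A. (\<forall>i. 0 \<le> h i x) \<and> (\<forall>i\<in>S. h i x = 0)}"

lemma affine_combination:
  assumes "affine A" "x \<in> A" "y \<in> A"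
  shows "(1 - t) *\<^sub>R x + t *\<^sub>R y \<in> A"
  using assms by (auto simp: affine_def)

lemma convex_tight_set:
  assumes "affine A" "\<And>i. affine_map (h i)"
  shows "convex (tight_set A h S)"
  using assms by (auto simp: convex_alt tight_set_def affine_map_def affine_combination)

text \<open>A nonnegative affine function that vanishes strictly inside a segment vanishes at both
  ends.\<close>

lemma tight_set_face_of:
  assumes "affine A" and h: "\<And>i. affine_map (h i)"
  shows "tight_set A h S face_of tight_set A h {}"
  unfolding face_of_def
proof (intro conjI ballI impI)
  show "tight_set A h S \<subseteq> tight_set A h {}" by (auto simp: tight_set_def)
  show "convex (tight_set A h S)" using assms by (rule convex_tight_set)
next
  fix a b x
  assume ab: "a \<in> tight_set A h {}" "b \<in> tight_set A h {}"
    and x: "x \<in> tight_set A h S" "x \<in> open_segment a b"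
  then obtain u where u: "0 < u" "u < 1" "x = (1 - u) *\<^sub>R a + u *\<^sub>R b"
    by (auto simp: in_segment)
  have "h i a = 0 \<and> h i b = 0" if "i \<in> S" for i
  proof -
    have "(1 - u) * h i a + u * h i b = 0"
      using x(1) that h[of i] u(3) by (auto simp: affine_map_def tight_set_def)
    moreover have "0 \<le> (1 - u) * h i a" "0 \<le> u * h i b"
      using ab u by (auto simp: tight_set_def)
    ultimately have "(1 - u) * h i a = 0" "u * h i b = 0" by linarith+
    then show ?thesis using u by simp
  qed
  then show "a \<in> tight_set A h S" "b \<in> tight_set A h S"
    using ab by (auto simp: tight_set_def)
qed

text \<open>
  The set \<open>S\<close> consists of the inequalities tight at a relative interior point of the face.
\<close>

lemma face_of_tight_set:
  fixes h :: "'i::finite \<Rightarrow> 'a::euclidean_space \<Rightarrow> real"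
  assumes A: "affine A" and h: "\<And>i. affine_map (h i)"
    and F: "F face_of tight_set A h {}" "F \<noteq> {}"
  obtains S where "F = tight_set A h S"
proof -
  have "convex F" using F face_of_imp_convex by blast
  then obtain x where x: "x \<in> rel_interior F"
    using F(2) rel_interior_eq_empty by blast
  then have xF: "x \<in> F" using rel_interior_subset by blast
  have FP: "F \<subseteq> tight_set A h {}" using F(1) face_of_imp_subset by blast
  define S where "S = {i. h i x = 0}"
  have hc: "h i ((1 - t) *\<^sub>R y + t *\<^sub>R z) = (1 - t) * h i y + t * h i z" for i t y z
    using h[of i] by (simp add: affine_map_def)
  have "F = tight_set A h S"
  proof (intro equalityI subsetI)
    fix y assume y: "y \<in> F"
    have "h i y = 0" if i: "i \<in> S" for i
    proof (rule ccontr)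
      assume "h i y \<noteq> 0"
      then have pos: "h i y > 0" using y FP less_le by (fastforce simp: tight_set_def)
      \<comment> \<open>Relative interiority prolongs the segment from \<open>y\<close> to
        \<open>x\<close> beyond \<open>x\<close> within \<open>F\<close>; there \<open>h i\<close>
        would be negative.\<close>
      obtain e where e: "e > 1" "(1 - e) *\<^sub>R y + e *\<^sub>R x \<in> F"
        using convex_rel_interior_if2[OF \<open>convex F\<close> x] y hull_subset[of F affine] by blast
      then have "0 \<le> (1 - e) * h i y + e * h i x"
        using FP by (auto simp: tight_set_def simp flip: hc)
      then have "0 \<le> (1 - e) * h i y" using i by (simp add: S_def)
      then show False using e(1) pos by (simp add: zero_le_mult_iff)
    qed
    then show "y \<in> tight_set A h S" using y FP by (auto simp: tight_set_def)
  next
    fix y assume y: "y \<in> tight_set A h S"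
    obtain e where e: "0 < e" "\<And>i. e * \<bar>h i y - h i x\<bar> \<le> h i x"
    proof (rule small_step[of UNIV "\<lambda>i. h i x" "\<lambda>i. h i y - h i x"])
      show "0 \<le> h i x" for i using xF FP by (auto simp: tight_set_def)
      show "h i y - h i x = 0" if "h i x = 0" for i
        using that y by (auto simp: tight_set_def S_def)
    qed auto
    \<comment> \<open>The point \<open>z\<close> lies beyond \<open>x\<close> as seen from
      \<open>y\<close>, and the choice of \<open>e\<close> keeps it in the polyhedron. Unless
      \<open>y = x\<close>, the point \<open>x\<close> is strictly between \<open>z\<close> and
      \<open>y\<close>, so the face property puts \<open>y\<close> into \<open>F\<close>.\<close>
    define z where "z = (1 - (1 + e)) *\<^sub>R y + (1 + e) *\<^sub>R x"
    have hz: "h i z = h i x - e * (h i y - h i x)" for i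
      unfolding z_def hc by (simp add: algebra_simps)
    have "e * (h i y - h i x) \<le> h i x" for i
      using e(2)[of i] e(1) by (smt (verit) mult_left_mono)
    then have "0 \<le> h i z" for i
      unfolding hz by simp
    moreover have "z \<in> A"
      unfolding z_def using A xF y FP by (intro affine_combination) (auto simp: tight_set_def)
    ultimately have zP: "z \<in> tight_set A h {}" by (simp add: tight_set_def)
    show "y \<in> F"
    proof (cases "y = x")
      case False
      have "(1 + e) *\<^sub>R (x - y) = z - y" by (simp add: z_def algebra_simps)
      then have "z \<noteq> y" using False e(1) by auto
      moreover have "x = (1 - e / (1 + e)) *\<^sub>R z + (e / (1 + e)) *\<^sub>R y"
      proof -
        define k where "k = e / (1 + e)"
        have k: "(1 - k) * (1 + e) = 1" "(1 - k) * (1 - (1 + e)) + k = 0"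
          using e(1) by (simp_all add: k_def field_simps)
        have "(1 - k) *\<^sub>R z + k *\<^sub>R y
            = ((1 - k) * (1 - (1 + e)) + k) *\<^sub>R y + ((1 - k) * (1 + e)) *\<^sub>R x"
          unfolding z_def by (simp only: scaleR_add_right scaleR_add_left scaleR_scaleR add.assoc)
            (simp add: algebra_simps)
        then show ?thesis unfolding k by (simp flip: k_def)
      qed
      ultimately have "x \<in> open_segment z y"
        using e(1) by (auto simp: in_segment intro!: exI[of _ "e / (1 + e)"])
      then show ?thesis
        using face_ofD[OF F(1)] zP y xF by (auto simp: tight_set_def)
    qed (use xF in simp)
  qed
  then show ?thesis using that by blast
qed

section \<open>Face lattices from incidences\<close>

text \<open>Faces are thereby determined by the labels of the generators they contain, even if
  several labels name one point.\<close>

lemma face_of_hull_image: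
  fixes v :: "'j \<Rightarrow> 'a::euclidean_space"
  assumes "finite J" "F face_of convex hull (v ` J)"
  shows "F = convex hull (v ` {a\<in>J. v a \<in> F})"
proof
  obtain S where S: "S \<subseteq> v ` J" "F = convex hull S"
    using face_of_convex_hull_subset[OF _ assms(2)] assms(1) finite_imp_compact by blast
  moreover have "S \<subseteq> F" unfolding S(2) by (rule hull_subset)
  ultimately have "S \<subseteq> v ` {a\<in>J. v a \<in> F}" by blast
  then show "F \<subseteq> convex hull (v ` {a\<in>J. v a \<in> F})"
    using S(2) hull_mono by blast
  show "convex hull (v ` {a\<in>J. v a \<in> F}) \<subseteq> F"
    using face_of_imp_convex[OF assms(2)] by (intro hull_minimal) auto
qed

text \<open>A nonempty face is cut out by a set of tight inequalities. Imposing the same set on the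
  other polyhedron selects the same labels, since membership of a labelled point depends only on its
  incidences. The empty face is separate because \<open>face_of_tight_set\<close> excludes
  it.\<close>

lemma face_with_same_vertices:
  fixes h :: "'i::finite \<Rightarrow> 'a::euclidean_space \<Rightarrow> real"
    and h' :: "'i \<Rightarrow> 'b::euclidean_space \<Rightarrow> real"
  assumes "affine A" "\<And>i. affine_map (h i)" "affine A'" "\<And>i. affine_map (h' i)"
    and v: "\<And>a. a \<in> J \<Longrightarrow> v a \<in> tight_set A h {}"
    and v': "\<And>a. a \<in> J \<Longrightarrow> v' a \<in> tight_set A' h' {}"
    and inc: "\<And>i a. a \<in> J \<Longrightarrow> h i (v a) = 0 \<longleftrightarrow> h' i (v' a) = 0"
    and F: "F face_of tight_set A h {}"
  obtains F' where "F' face_of tight_set A' h' {}" "{a\<in>J. v a \<in> F} = {a\<in>J. v' a \<in> F'}"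
proof (cases "F = {}")
  case True
  then show ?thesis using that[of "{}"] by simp
next
  case False
  then obtain S where S: "F = tight_set A h S"
    using face_of_tight_set assms(1,2) F by metis
  have "{a\<in>J. v a \<in> F} = {a\<in>J. v' a \<in> tight_set A' h' S}"
    using v v' inc unfolding S tight_set_def by auto
  then show ?thesis using that tight_set_face_of assms(3,4) by metis
qed

text \<open>By the two preceding lemmas, both face lattices embed into the subsets of
  \<open>J\<close> with the same image.\<close>

lemma face_lattice_iso_of_incidence:
  fixes h :: "'i::finite \<Rightarrow> 'a::euclidean_space \<Rightarrow> real"
    and h' :: "'i \<Rightarrow> 'b::euclidean_space \<Rightarrow> real"
  assumes A: "affine A" "\<And>i. affine_map (h i)" and A': "affine A'" "\<And>i. affine_map (h' i)"
    and J: "finite J"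
    and P: "tight_set A h {} = convex hull (v ` J)"
    and P': "tight_set A' h' {} = convex hull (v' ` J)"
    and inc: "\<And>i a. a \<in> J \<Longrightarrow> h i (v a) = 0 \<longleftrightarrow> h' i (v' a) = 0"
  shows "face_lattice_iso (\<lambda>F. convex hull (v' ` {a\<in>J. v a \<in> F}))
           (tight_set A h {}) (tight_set A' h' {})"
proof -
  let ?P = "tight_set A h {}" and ?P' = "tight_set A' h' {}"
  let ?W = "\<lambda>F. {a\<in>J. v a \<in> F}" and ?W' = "\<lambda>F. {a\<in>J. v' a \<in> F}"
  let ?f = "\<lambda>F. convex hull (v' ` ?W F)"
  have v: "v a \<in> ?P" "v' a \<in> ?P'" if "a \<in> J" for a
    using that unfolding P P' by (auto intro: hull_inc)
  have hull: "F = convex hull (v ` ?W F)" if "F face_of ?P" for F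
    using face_of_hull_image[OF J] that unfolding P by blast
  have hull': "F = convex hull (v' ` ?W' F)" if "F face_of ?P'" for F
    using face_of_hull_image[OF J] that unfolding P' by blast
  have f: "?f F face_of ?P'" "?W' (?f F) = ?W F" if F: "F face_of ?P" for F
  proof -
    obtain F' where F': "F' face_of ?P'" "?W F = ?W' F'"
      by (rule face_with_same_vertices[OF A A' v inc F])
    then have "?f F = F'" using hull'[OF F'(1), symmetric] by simp
    then show "?f F face_of ?P'" "?W' (?f F) = ?W F" using F' by auto
  qed
  have mono: "F \<subseteq> G \<longleftrightarrow> ?W F \<subseteq> ?W G" if "F face_of ?P" "G face_of ?P" for F G
  proof
    assume "?W F \<subseteq> ?W G"
    then have "convex hull (v ` ?W F) \<subseteq> convex hull (v ` ?W G)"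
      by (intro hull_mono image_mono)
    then show "F \<subseteq> G" using hull[OF that(1), symmetric] hull[OF that(2), symmetric] by simp
  qed auto
  have mono': "F \<subseteq> G \<longleftrightarrow> ?W' F \<subseteq> ?W' G" if "F face_of ?P'" "G face_of ?P'" for F G
  proof
    assume "?W' F \<subseteq> ?W' G"
    then have "convex hull (v' ` ?W' F) \<subseteq> convex hull (v' ` ?W' G)"
      by (intro hull_mono image_mono)
    then show "F \<subseteq> G" using hull'[OF that(1), symmetric] hull'[OF that(2), symmetric] by simp
  qed auto
  have order: "F \<subseteq> G \<longleftrightarrow> ?f F \<subseteq> ?f G" if "F face_of ?P" "G face_of ?P" for F G
    using mono[OF that] mono'[OF f(1)[OF that(1)] f(1)[OF that(2)]] f(2)[OF that(1)] f(2)[OF that(2)]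
    by simp
  have surj: "\<exists>F. F face_of ?P \<and> ?f F = F'" if F': "F' face_of ?P'" for F'
  proof -
    obtain F where "F face_of ?P" "?W' F' = ?W F"
      by (rule face_with_same_vertices[OF A' A v(2,1) inc[symmetric] F'])
    then show ?thesis using hull'[OF F', symmetric] by auto
  qed
  have "bij_betw ?f {F. F face_of ?P} {F. F face_of ?P'}"
    unfolding bij_betw_def
  proof
    show "inj_on ?f {F. F face_of ?P}"
    proof (rule inj_onI)
      fix F G assume FG: "F \<in> {F. F face_of ?P}" "G \<in> {F. F face_of ?P}" "?f F = ?f G"
      then show "F = G" using order[of F G] order[of G F] by (intro equalityI) simp_all
    qed
    show "?f ` {F. F face_of ?P} = {F. F face_of ?P'}"
      using f(1) surj by blast
  qed
  then show ?thesis unfolding face_lattice_iso_def using order by blast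
qed

section \<open>Polytopes cut from a simplex by reciprocal matrices\<close>

definition reciprocal :: "real ^ 'n ^ 'n \<Rightarrow> bool" where
  "reciprocal A \<longleftrightarrow> (\<forall>i. A $ i $ i = -1) \<and>
     (\<forall>i j. i \<noteq> j \<longrightarrow> 0 < A $ i $ j \<and> A $ i $ j * A $ j $ i = 1)"

definition sum_two_plane :: "(real ^ 'n) set" where
  "sum_two_plane = {x. (\<Sum>i\<in>UNIV. x $ i) = 2}"

text \<open>\<open>Inl i\<close> stands for the facet \<open>F_i\<close> and \<open>Inr i\<close>
  for \<open>G_i\<close>: with ones off the diagonal, \<open>(A *v x) $ i\<close> equals
  \<open>2 - 2 * x $ i\<close> on the plane.\<close>

definition slack :: "real ^ 'n ^ 'n \<Rightarrow> 'n + 'n \<Rightarrow> real ^ 'n \<Rightarrow> real" where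
  "slack A l x = (case l of Inl i \<Rightarrow> x $ i | Inr i \<Rightarrow> (A *v x) $ i)"

text \<open>For reciprocal \<open>A\<close> this is combinatorially the rectified simplex.\<close>

definition rectified :: "real ^ 'n ^ 'n \<Rightarrow> (real ^ 'n) set" where
  "rectified A = tight_set sum_two_plane (slack A) {}"

text \<open>
  The point of the edge \<open>e\<^sub>i e\<^sub>j\<close> on the hyperplane \<open>(A x)\<^sub>i = 0\<close>, scaled to coordinate sum \<open>2\<close>; by
  reciprocity it depends only on the unordered pair. It has no meaning for \<open>i = j\<close>, where the
  denominator vanishes.
\<close>

definition edge_point :: "real ^ 'n ^ 'n \<Rightarrow> 'n \<times> 'n \<Rightarrow> real ^ 'n" where
  "edge_point A = (\<lambda>(i, j). (2 / (1 + A $ i $ j)) *\<^sub>R (A $ i $ j *\<^sub>R axis i 1 + axis j 1))"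

text \<open>Each edge occurs in both orientations. For reciprocal matrices these label the same
  \<open>edge_point\<close>, which is harmless since only the image matters as a generating
  set.\<close>

definition ordered_edges :: "('n \<times> 'n) set" where
  "ordered_edges = {(i, j). i \<noteq> j}"

lemma reciprocalD:
  assumes "reciprocal A"
  shows "A $ i $ i = -1" "i \<noteq> j \<Longrightarrow> 0 < A $ i $ j" "i \<noteq> j \<Longrightarrow> A $ i $ j * A $ j $ i = 1"
  using assms by (auto simp: reciprocal_def)

lemma affine_sum_two_plane: "affine sum_two_plane"
  by (auto simp: affine_def sum_two_plane_def sum.distrib simp flip: sum_distrib_left distrib_right)

lemma matvec_component: "(A *v x) $ k = (\<Sum>m\<in>UNIV. A $ k $ m * x $ m)"
  by (simp add: matrix_vector_mult_def)

lemma linear_slack: "linear (slack A l)"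
  by (rule linearI) (auto simp: slack_def matvec_component sum.distrib sum_distrib_left algebra_simps
      split: sum.split)

lemma affine_map_linear: "linear f \<Longrightarrow> affine_map f"
  by (simp add: affine_map_def linear_add linear_scale)

lemma affine_map_slack: "affine_map (slack A l)"
  by (rule affine_map_linear[OF linear_slack])

lemma sum_two_support:
  fixes f :: "'n::finite \<Rightarrow> real"
  assumes "i \<noteq> j" "\<And>m. m \<noteq> i \<Longrightarrow> m \<noteq> j \<Longrightarrow> f m = 0"
  shows "sum f UNIV = f i + f j"
proof -
  have "sum f UNIV = sum f {i, j}"
    using assms by (intro sum.mono_neutral_right) auto
  then show ?thesis using assms by simp
qed

lemma matvec_split:
  assumes "reciprocal A"
  shows "(A *v x) $ k = (\<Sum>m\<in>UNIV - {k}. A $ k $ m * x $ m) - x $ k"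
  using reciprocalD(1)[OF assms, of k] by (simp add: matvec_component sum.remove[of UNIV k])

lemma edge_point_nth:
  assumes "i \<noteq> j"
  shows "edge_point A (i, j) $ m =
    (if m = i then 2 * A $ i $ j / (1 + A $ i $ j) else if m = j then 2 / (1 + A $ i $ j) else 0)"
  using assms by (auto simp: edge_point_def axis_def)

text \<open>Row \<open>i\<close> vanishes by construction; row \<open>j\<close> is a multiple of
  \<open>A $ j $ i * A $ i $ j - 1\<close>, zero by reciprocity.\<close>

lemma matvec_edge_point:
  assumes A: "reciprocal A" and ij: "i \<noteq> j"
  shows "(A *v edge_point A (i, j)) $ k =
    (if k = i \<or> k = j then 0 else 2 * (A $ k $ i * A $ i $ j + A $ k $ j) / (1 + A $ i $ j))"
proof -
  have "(A *v edge_point A (i, j)) $ k =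
      A $ k $ i * edge_point A (i, j) $ i + A $ k $ j * edge_point A (i, j) $ j"
    unfolding matvec_component by (rule sum_two_support) (use ij in \<open>auto simp: edge_point_nth\<close>)
  then have eq: "(A *v edge_point A (i, j)) $ k
      = A $ k $ i * (2 * A $ i $ j / (1 + A $ i $ j)) + A $ k $ j * (2 / (1 + A $ i $ j))"
    using ij by (simp add: edge_point_nth)
  have frac: "x * (2 * a / b) + y * (2 / b) = 2 * (x * a + y) / b" for x y a b :: real
    by (simp add: distrib_left add_divide_distrib mult_ac)
  have "A $ j $ i * A $ i $ j = 1"
    using reciprocalD(3)[OF A ij] by (simp add: mult.commute)
  then show ?thesis
    unfolding eq frac using reciprocalD(1)[OF A] by auto
qed

text \<open>The incidence criterion does not mention \<open>A\<close>; this makes all reciprocal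
  matrices give the same face lattice.\<close>

lemma slack_edge_point:
  assumes A: "reciprocal A" and "a \<in> ordered_edges"
  shows "0 \<le> slack A l (edge_point A a)"
    and "slack A l (edge_point A a) = 0 \<longleftrightarrow>
      (case l of Inl k \<Rightarrow> k \<noteq> fst a \<and> k \<noteq> snd a | Inr k \<Rightarrow> k = fst a \<or> k = snd a)"
proof -
  obtain i j where a: "a = (i, j)" "i \<noteq> j" using assms by (auto simp: ordered_edges_def)
  have pos: "0 < A $ i $ j" "0 < 1 + A $ i $ j"
    using reciprocalD(2)[OF A a(2)] by auto
  have "0 < 2 * (A $ k $ i * A $ i $ j + A $ k $ j) / (1 + A $ i $ j)" if "k \<noteq> i" "k \<noteq> j" for k
    using reciprocalD(2)[OF A that(1)] reciprocalD(2)[OF A that(2)] pos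
    by (intro divide_pos_pos mult_pos_pos add_pos_pos) auto
  note pos = pos this
  show "0 \<le> slack A l (edge_point A a)"
    using a pos less_imp_le[OF pos(3)]
    by (auto simp: slack_def matvec_edge_point[OF A] edge_point_nth split: sum.split)
  show "slack A l (edge_point A a) = 0 \<longleftrightarrow>
      (case l of Inl k \<Rightarrow> k \<noteq> fst a \<and> k \<noteq> snd a | Inr k \<Rightarrow> k = fst a \<or> k = snd a)"
    using a pos less_imp_neq[OF pos(3)]
    by (auto simp: slack_def matvec_edge_point[OF A] edge_point_nth split: sum.split)
qed

lemma edge_point_sum:
  assumes "reciprocal A" and ij: "i \<noteq> j"
  shows "(\<Sum>m\<in>UNIV. edge_point A (i, j) $ m) = 2"
proof -
  have "(\<Sum>m\<in>UNIV. edge_point A (i, j) $ m) = edge_point A (i, j) $ i + edge_point A (i, j) $ j"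
    by (rule sum_two_support) (use ij in \<open>auto simp: edge_point_nth\<close>)
  also have "\<dots> = 2 * (1 + A $ i $ j) / (1 + A $ i $ j)"
    using ij by (simp add: edge_point_nth add_divide_distrib)
  also have "\<dots> = 2"
    using reciprocalD(2)[OF assms] by (intro nonzero_mult_div_cancel_right) simp
  finally show ?thesis .
qed

lemma edge_point_rectified:
  assumes "reciprocal A" "a \<in> ordered_edges"
  shows "edge_point A a \<in> rectified A"
  using assms edge_point_sum[OF assms(1)] slack_edge_point(1)[OF assms]
  by (auto simp: rectified_def tight_set_def sum_two_plane_def ordered_edges_def)

lemma rectifiedD:
  assumes "x \<in> rectified A"
  shows "(\<Sum>i\<in>UNIV. x $ i) = 2" "0 \<le> x $ i" "0 \<le> (A *v x) $ i"
proof -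
  have s: "0 \<le> slack A l x" for l using assms by (simp add: rectified_def tight_set_def)
  show "(\<Sum>i\<in>UNIV. x $ i) = 2" using assms by (simp add: rectified_def tight_set_def sum_two_plane_def)
  show "0 \<le> x $ i" "0 \<le> (A *v x) $ i" using s[of "Inl i"] s[of "Inr i"] by (simp_all add: slack_def)
qed

lemma rectifiedI:
  assumes "(\<Sum>i\<in>UNIV. x $ i) = 2" "\<And>i. 0 \<le> x $ i" "\<And>i. 0 \<le> (A *v x) $ i"
  shows "x \<in> rectified A"
  using assms by (auto simp: rectified_def tight_set_def sum_two_plane_def slack_def split: sum.split)

text \<open>Rows \<open>i\<close> and \<open>j\<close> bound the ratio of the two coordinates from
  both sides, by reciprocity with the same value; the coordinate sum fixes the scale.\<close>

lemma rectified_two_support: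
  assumes A: "reciprocal A" and x: "x \<in> rectified A" and ij: "i \<noteq> j"
    and supp: "\<And>m. m \<noteq> i \<Longrightarrow> m \<noteq> j \<Longrightarrow> x $ m = 0"
  shows "x = edge_point A (i, j)"
proof -
  have mv: "(A *v x) $ k = A $ k $ i * x $ i + A $ k $ j * x $ j" for k
    unfolding matvec_component by (rule sum_two_support) (use ij supp in auto)
  have r: "A $ i $ i = -1" "A $ j $ j = -1" "0 < A $ i $ j" "A $ i $ j * A $ j $ i = 1"
    using reciprocalD[OF A] ij by auto
  have le: "x $ i \<le> A $ i $ j * x $ j" "x $ j \<le> A $ j $ i * x $ i"
    using rectifiedD(3)[OF x, of i] rectifiedD(3)[OF x, of j] r by (auto simp: mv)
  have "A $ i $ j * x $ j \<le> A $ i $ j * (A $ j $ i * x $ i)"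
    using le(2) r(3) by (intro mult_left_mono) auto
  also have "\<dots> = x $ i" using r(4) by (simp flip: mult.assoc)
  finally have eq: "x $ i = A $ i $ j * x $ j" using le(1) by simp
  have "x $ i + x $ j = 2"
    using rectifiedD(1)[OF x] sum_two_support[OF ij, of "\<lambda>m. x $ m"] supp by simp
  then have "x $ j * (1 + A $ i $ j) = 2" using eq by (simp add: algebra_simps)
  then have xj: "x $ j = 2 / (1 + A $ i $ j)" using r(3) by (simp add: field_simps)
  show ?thesis
    using xj eq ij supp by (auto simp: vec_eq_iff edge_point_nth)
qed

text \<open>
  Two tight inequalities \<open>(A x)\<^sub>i = 0 = (A x)\<^sub>l\<close> force the support into \<open>{i, l}\<close>. With at most one,
  at index \<open>i\<close>, and two further support elements \<open>j, k\<close>, the point \<open>x\<close> can be moved both ways along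
  the difference of the vertices on the edges \<open>e\<^sub>i e\<^sub>j\<close> and \<open>e\<^sub>i e\<^sub>k\<close>.
\<close>

lemma extreme_point_rectified:
  assumes A: "reciprocal A" and x: "x extreme_point_of rectified A"
  shows "x \<in> edge_point A ` ordered_edges"
proof (rule ccontr)
  assume "x \<notin> edge_point A ` ordered_edges"
  then have nv: "x \<noteq> edge_point A (i, j)" if "i \<noteq> j" for i j
    using that by (auto simp: ordered_edges_def)
  have xP: "x \<in> rectified A" using x by (simp add: extreme_point_of_def)
  note xD = rectifiedD[OF xP]
  have nn: "0 \<le> A $ k $ m * x $ m" if "m \<noteq> k" for k m
    using reciprocalD(2)[OF A, of k m] xD(2)[of m] that by simp
  have two_tight: False if il: "i \<noteq> l" "(A *v x) $ i = 0" "(A *v x) $ l = 0" for i l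
  proof -
    have ge: "A $ k $ m * x $ m + (A $ k $ n * x $ n) \<le> x $ k"
      if "(A *v x) $ k = 0" "m \<noteq> n" "m \<noteq> k" "n \<noteq> k" for k m n
    proof -
      have "(\<Sum>r\<in>{m, n}. A $ k $ r * x $ r) \<le> (\<Sum>r\<in>UNIV - {k}. A $ k $ r * x $ r)"
        using that nn by (intro sum_mono2) auto
      then show ?thesis using that matvec_split[OF A, of x k] by simp
    qed
    have "x $ m = 0" if m: "m \<noteq> i" "m \<noteq> l" for m
    proof -
      have a: "0 < A $ i $ l" "A $ i $ l * A $ l $ i = 1" "0 < A $ i $ m" "0 < A $ l $ m"
        using reciprocalD[OF A] il(1) m by auto
      \<comment> \<open>Row \<open>l\<close> is scaled by \<open>A $ i $ l\<close> and combined with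
        row \<open>i\<close>. The terms in \<open>x $ i\<close> and \<open>x $ l\<close> cancel,
        leaving a positive multiple of \<open>x $ m\<close> bounded above by zero.\<close>
      have "A $ i $ l * (A $ l $ i * x $ i + A $ l $ m * x $ m) \<le> A $ i $ l * x $ l"
        using ge[OF il(3), of i m] m il(1) a(1) by (intro mult_left_mono) auto
      moreover have "A $ i $ l * (A $ l $ i * x $ i) = x $ i"
        using a(2) by (simp flip: mult.assoc)
      moreover have "0 \<le> A $ i $ l * (A $ l $ m * x $ m)" using a xD(2) by simp
      ultimately have "A $ i $ m * x $ m \<le> 0"
        using ge[OF il(2), of l m] m il(1) by (simp add: distrib_left)
      then show ?thesis using a(3) xD(2)[of m] by (simp add: mult_le_0_iff)
    qed
    then show False using rectified_two_support[OF A xP il(1)] nv[OF il(1)] by blast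
  qed
  \<comment> \<open>The index of the tight row serves if there is one, and any support index
    otherwise.\<close>
  have "\<exists>i. x $ i > 0 \<and> (\<forall>l. l \<noteq> i \<longrightarrow> (A *v x) $ l > 0)"
  proof (cases "\<exists>i. (A *v x) $ i = 0")
    case True
    then obtain i where i: "(A *v x) $ i = 0" by blast
    have "x $ i \<noteq> 0"
    proof
      assume 0: "x $ i = 0"
      then have "(\<Sum>m\<in>UNIV - {i}. A $ i $ m * x $ m) = 0" using i matvec_split[OF A, of x i] by simp
      then have *: "\<forall>m\<in>UNIV - {i}. A $ i $ m * x $ m = 0"
        using nn by (subst (asm) sum_nonneg_eq_0_iff) auto
      have "x $ m = 0" for m
        using 0 bspec[OF *, of m] reciprocalD(2)[OF A, of i m] by (cases "m = i") auto
      then show False using xD(1) by simp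
    qed
    then show ?thesis using two_tight i xD(2,3) by (metis order_le_less)
  next
    case False
    have "\<exists>i. x $ i \<noteq> 0"
      using xD(1) by (rule_tac ccontr) simp
    then show ?thesis using False xD(2,3) by (metis order_le_less)
  qed
  then obtain i where i: "x $ i > 0" "\<And>l. l \<noteq> i \<Longrightarrow> (A *v x) $ l > 0" by blast
  have "\<exists>j. j \<noteq> i \<and> x $ j \<noteq> 0"
  proof (rule ccontr)
    assume "\<not> ?thesis"
    then have "(\<Sum>m\<in>UNIV - {i}. A $ i $ m * x $ m) = 0" by (intro sum.neutral) auto
    then show False using xD(3)[of i] i(1) matvec_split[OF A, of x i] by simp
  qed
  then obtain j where j: "j \<noteq> i" "x $ j \<noteq> 0" by blast
  then obtain k where k: "k \<noteq> i" "k \<noteq> j" "x $ k \<noteq> 0"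
    using rectified_two_support[OF A xP, of i j] nv[of i j] by blast
  \<comment> \<open>Every inequality tight at \<open>x\<close> is constant along \<open>d\<close>:
    the support of \<open>d\<close> lies in \<open>{i, j, k}\<close>, and row \<open>i\<close>
    annihilates both edge points.\<close>
  define d where "d = edge_point A (i, j) - edge_point A (i, k)"
  obtain e where e: "0 < e" "\<And>l. l \<in> UNIV \<Longrightarrow> e * \<bar>slack A l d\<bar> \<le> slack A l x"
  proof (rule small_step[of UNIV "\<lambda>l. slack A l x" "\<lambda>l. slack A l d"])
    show "0 \<le> slack A l x" for l using xP by (simp add: rectified_def tight_set_def)
    show "slack A l d = 0" if "slack A l x = 0" for l
    proof (cases l)
      case (Inl m)
      then have "m \<noteq> i" "m \<noteq> j" "m \<noteq> k" using that i(1) j k by (auto simp: slack_def)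
      then show ?thesis using Inl j k by (simp add: slack_def d_def edge_point_nth)
    next
      case (Inr m)
      then have "m = i" using that i(2)[of m] by (force simp: slack_def)
      then show ?thesis using Inr j k
        by (simp add: slack_def d_def matrix_vector_mult_diff_distrib matvec_edge_point[OF A])
    qed
  qed auto
  have "(\<Sum>m\<in>UNIV. d $ m) = 0"
    using edge_point_sum[OF A] j(1) k(1) by (simp add: d_def sum_subtractf)
  then have "x + t *\<^sub>R d \<in> sum_two_plane" for t
    using xD(1) by (simp add: sum_two_plane_def sum.distrib flip: sum_distrib_left)
  moreover have "0 \<le> slack A l (x + t *\<^sub>R d)" if "\<bar>t\<bar> = e" for t l
  proof -
    have "\<bar>t * slack A l d\<bar> \<le> slack A l x" using e(2)[of l] that by (simp add: abs_mult)
    then show ?thesis by (simp add: linear_add[OF linear_slack] linear_scale[OF linear_slack])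
  qed
  ultimately have mem: "x + t *\<^sub>R d \<in> rectified A" if "\<bar>t\<bar> = e" for t
    using that by (simp add: rectified_def tight_set_def)
  have "d $ j \<noteq> 0"
    using j k reciprocalD(2)[OF A, of i j] by (simp add: d_def edge_point_nth)
  then have "d \<noteq> 0" by auto
  have "x = midpoint (x + (- e) *\<^sub>R d) (x + e *\<^sub>R d)"
    by (simp add: midpoint_def scaleR_2[symmetric])
  moreover have "x + (- e) *\<^sub>R d \<noteq> x + e *\<^sub>R d"
    using \<open>d \<noteq> 0\<close> e(1) by (simp add: eq_neg_iff_add_eq_0 flip: scaleR_minus_left scaleR_add_left)
  ultimately have "x \<in> open_segment (x + (- e) *\<^sub>R d) (x + e *\<^sub>R d)"
    by (metis midpoint_in_open_segment)
  then show False
    using x mem[of e] mem[of "- e"] e(1) by (auto simp: extreme_point_of_def)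
qed

lemma compact_rectified: "compact (rectified A)"
proof -
  have eq: "rectified A = {x. (\<Sum>i\<in>UNIV. x $ i) = 2} \<inter> (\<Inter>l. {x. 0 \<le> slack A l x})"
    by (auto simp: rectified_def tight_set_def sum_two_plane_def)
  have "continuous_on UNIV (slack A l)" for l
    using linear_continuous_on linear_slack by (metis linear_conv_bounded_linear)
  then have "closed (rectified A)"
    unfolding eq
    by (intro closed_Int closed_INT ballI closed_Collect_eq closed_Collect_le continuous_intros)
  moreover have "rectified A \<subseteq> cbox 0 (\<chi> i. 2)"
  proof
    fix x assume x: "x \<in> rectified A"
    have "x $ i \<le> 2" for i
      using rectifiedD[OF x] member_le_sum[of i UNIV "\<lambda>i. x $ i"] by auto
    then show "x \<in> cbox 0 (\<chi> i. 2)" using rectifiedD(2)[OF x] by (simp add: mem_box_cart)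
  qed
  ultimately show ?thesis
    using bounded_subset[OF bounded_cbox] by (auto simp: compact_eq_bounded_closed)
qed

lemma convex_rectified: "convex (rectified A)"
  unfolding rectified_def by (rule convex_tight_set[OF affine_sum_two_plane affine_map_slack])

text \<open>Krein-Milman reduces the nontrivial inclusion to extreme points.\<close>

lemma rectified_eq_hull:
  assumes "reciprocal A"
  shows "rectified A = convex hull (edge_point A ` ordered_edges)"
proof
  show "rectified A \<subseteq> convex hull (edge_point A ` ordered_edges)"
    using Krein_Milman_Minkowski[OF compact_rectified convex_rectified, of A]
      hull_mono[of "{x. x extreme_point_of rectified A}" "edge_point A ` ordered_edges" convex]
      extreme_point_rectified[OF assms] by auto
  show "convex hull (edge_point A ` ordered_edges) \<subseteq> rectified A"
    using edge_point_rectified[OF assms] convex_rectified by (intro hull_minimal) auto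
qed

section \<open>The hypersimplex as the case of unit entries\<close>

definition unit_reciprocal :: "real ^ 'n ^ 'n" where
  "unit_reciprocal = (\<chi> i j. if i = j then -1 else 1)"

lemma reciprocal_unit: "reciprocal unit_reciprocal"
  by (simp add: reciprocal_def unit_reciprocal_def)

lemma matvec_unit_reciprocal: "(unit_reciprocal *v x) $ k = (\<Sum>m\<in>UNIV. x $ m) - 2 * x $ k"
  by (simp add: matvec_split[OF reciprocal_unit] sum.remove[of UNIV k]) (simp add: unit_reciprocal_def)

text \<open>On the plane the row inequalities read \<open>x $ i \<le> 1\<close>, so the 0/1 points
  satisfy them; conversely the edge points are 0/1 vectors.\<close>

lemma hypersimplex_two: "hypersimplex 2 = rectified unit_reciprocal"
proof
  show "hypersimplex 2 \<subseteq> rectified (unit_reciprocal :: real^'n^'n)"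
    unfolding hypersimplex_def
  proof (intro hull_minimal convex_rectified subsetI)
    fix x :: "real^'n"
    assume "x \<in> {x. (\<forall>i. x $ i \<in> {0, 1}) \<and> (\<Sum>i\<in>UNIV. x $ i) = real 2}"
    then have x: "x $ i = 0 \<or> x $ i = 1" "(\<Sum>i\<in>UNIV. x $ i) = 2" for i by auto
    show "x \<in> rectified unit_reciprocal"
    proof (rule rectifiedI)
      show "0 \<le> x $ i" "0 \<le> (unit_reciprocal *v x) $ i" for i
        using x(1)[of i] x(2) by (auto simp: matvec_unit_reciprocal)
    qed (rule x(2))
  qed
  have "edge_point unit_reciprocal ` ordered_edges \<subseteq>
      {x :: real^'n. (\<forall>i. x $ i \<in> {0, 1}) \<and> (\<Sum>i\<in>UNIV. x $ i) = real 2}"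
    using edge_point_sum[OF reciprocal_unit] by (auto simp: ordered_edges_def edge_point_nth unit_reciprocal_def)
  then show "rectified (unit_reciprocal :: real^'n^'n) \<subseteq> hypersimplex 2"
    unfolding rectified_eq_hull[OF reciprocal_unit] hypersimplex_def by (rule hull_mono)
qed

lemma edge_point_in_G_face:
  assumes "i \<noteq> j"
  shows "edge_point unit_reciprocal (i, j) \<in> G_face 2 i"
  using assms edge_point_rectified[OF reciprocal_unit, of "(i, j)"]
  by (simp add: G_face_def hypersimplex_two ordered_edges_def edge_point_nth) (simp add: unit_reciprocal_def)

section \<open>Transfer to full dimension and the common direction\<close>

text \<open>Identifies the target space with the subspace parallel to \<open>sum_two_plane\<close>,
  where the construction lives.\<close>

lemma hyperplane_coordinates:
  assumes "DIM('a::euclidean_space) = CARD('n) - 1"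
  obtains f :: "'a::euclidean_space \<Rightarrow> real ^ 'n" and g where "linear f" "linear g"
    "\<And>y. (\<Sum>i\<in>UNIV. f y $ i) = 0" "\<And>y. g (f y) = y"
    "\<And>x. (\<Sum>i\<in>UNIV. x $ i) = 0 \<Longrightarrow> f (g x) = x"
proof -
  let ?T = "{x :: real ^ 'n. (\<chi> i. 1) \<bullet> x = 0}"
  have T: "?T = {x. (\<Sum>i\<in>UNIV. x $ i) = 0}" by (simp add: inner_vec_def)
  have "((\<chi> i. 1) :: real ^ 'n) \<noteq> 0" by (simp add: vec_eq_iff)
  then have dims: "dim (UNIV :: 'a set) = dim ?T"
    using assms by (simp add: dim_hyperplane)
  obtain f :: "'a \<Rightarrow> real ^ 'n" and g where
    fg: "linear f" "linear g" "f ` UNIV = ?T" "\<And>x. x \<in> UNIV \<Longrightarrow> g (f x) = x"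
      "\<And>x. x \<in> ?T \<Longrightarrow> f (g x) = x"
    by (rule isometries_subspaces[OF subspace_UNIV subspace_hyperplane dims]) blast
  show ?thesis
  proof
    show "(\<Sum>i\<in>UNIV. f y $ i) = 0" for y using fg(3) unfolding T by auto
    show "f (g x) = x" if "(\<Sum>i\<in>UNIV. x $ i) = 0" for x using fg(5) that unfolding T by auto
  qed (use fg in auto)
qed

lemma affine_add_direction:
  fixes y :: "'j \<Rightarrow> 'a::real_vector"
  assumes S: "affine S" "x \<in> S" and y: "\<And>j. j \<in> J \<Longrightarrow> y j \<in> S" and c: "sum c J = 0"
  shows "x + (\<Sum>j\<in>J. c j *\<^sub>R y j) \<in> S"
proof -
  have "(\<Sum>j\<in>J. c j *\<^sub>R (y j - x)) \<in> (\<lambda>z. z - x) ` S"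
    using affine_diffs_subspace_subtract[OF S] y by (intro subspace_sum subspace_scale) auto
  moreover have "(\<Sum>j\<in>J. c j *\<^sub>R (y j - x)) = (\<Sum>j\<in>J. c j *\<^sub>R y j)"
    using c by (simp add: scaleR_diff_right sum_subtractf flip: scaleR_sum_left)
  ultimately show ?thesis by (auto simp: algebra_simps)
qed

text \<open>The coefficients cancel the denominators of \<open>edge_point\<close>. Coordinates other
  than \<open>i\<close> are then immediate, and coordinate \<open>i\<close> is row \<open>i\<close>
  of \<open>A *v p = 0\<close>.\<close>

lemma kernel_vector_as_combination:
  assumes A: "reciprocal A" and p: "A *v p = 0"
  shows "p = (\<Sum>j\<in>UNIV - {i}. (p $ j * (1 + A $ i $ j) / 2) *\<^sub>R edge_point A (i, j))"
proof -
  have scaled: "(p $ j * (1 + A $ i $ j) / 2) *\<^sub>R edge_point A (i, j)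
      = p $ j *\<^sub>R (A $ i $ j *\<^sub>R axis i 1 + axis j 1)" if "j \<noteq> i" for j
    using reciprocalD(2)[OF A, of i j] that by (simp add: edge_point_def)
  have *: "(\<Sum>j\<in>UNIV - {i}. p $ j *\<^sub>R (A $ i $ j *\<^sub>R axis i 1 + axis j 1)) $ m = p $ m" for m
  proof (cases "m = i")
    case True
    have "(\<Sum>j\<in>UNIV - {i}. p $ j *\<^sub>R (A $ i $ j *\<^sub>R axis i 1 + axis j 1)) $ i
        = (\<Sum>j\<in>UNIV - {i}. A $ i $ j * p $ j)"
      by (auto simp: axis_def intro!: sum.cong)
    also have "\<dots> = p $ i" using matvec_split[OF A, of p i] p by simp
    finally show ?thesis using True by simp
  next
    case False
    have "(\<Sum>j\<in>UNIV - {i}. p $ j *\<^sub>R (A $ i $ j *\<^sub>R axis i 1 + axis j 1)) $ m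
        = (\<Sum>j\<in>UNIV - {i}. if j = m then p $ j else 0)"
      unfolding sum_component by (rule sum.cong) (use False in \<open>auto simp: axis_def\<close>)
    also have "\<dots> = p $ m" using False by simp
    finally show ?thesis .
  qed
  have "p = (\<Sum>j\<in>UNIV - {i}. p $ j *\<^sub>R (A $ i $ j *\<^sub>R axis i 1 + axis j 1))"
    by (simp only: vec_eq_iff *) simp
  also have "\<dots> = (\<Sum>j\<in>UNIV - {i}. (p $ j * (1 + A $ i $ j) / 2) *\<^sub>R edge_point A (i, j))"
    by (rule sum.cong[OF refl], rule scaled[symmetric]) simp
  finally show ?thesis .
qed

text \<open>The strictly feasible point \<open>x0\<close> yields full dimension and becomes the
  origin; \<open>p\<close>, having coordinate sum zero, becomes a direction common to all
  \<open>G\<close>-hyperplanes.\<close>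

lemma nongeneric_of_kernel_vector:
  fixes A :: "real ^ 'n ^ 'n"
  assumes A: "reciprocal A" and dim: "DIM('a::euclidean_space) = CARD('n) - 1"
    and x0: "x0 \<in> sum_two_plane" "\<And>l. 0 < slack A l x0"
    and p: "A *v p = 0" "p \<noteq> 0" "(\<Sum>i\<in>UNIV. p $ i) = 0"
  shows "\<exists>(P :: 'a::euclidean_space set) (\<phi> :: (real ^ 'n) set \<Rightarrow> 'a set).
     combinatorial_hypersimplex 2 P \<phi> \<and> \<not> G_generic 2 \<phi>"
proof -
  obtain f :: "'a \<Rightarrow> real ^ 'n" and g where fg: "linear f" "linear g"
    "\<And>y. (\<Sum>i\<in>UNIV. f y $ i) = 0" "\<And>y. g (f y) = y"
    "\<And>x. (\<Sum>i\<in>UNIV. x $ i) = 0 \<Longrightarrow> f (g x) = x"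
    using hyperplane_coordinates[OF dim] by metis
  \<comment> \<open>\<open>M\<close> parametrises the plane with \<open>0\<close> sent to
    \<open>x0\<close>, and \<open>N\<close> inverts it there.\<close>
  define M where "M y = f y + x0" for y
  define N where "N x = g (x - x0)" for x
  have M_plane: "M y \<in> sum_two_plane" for y
    using x0(1) fg(3)[of y] by (simp add: M_def sum_two_plane_def sum.distrib)
  have NM: "N (M y) = y" for y by (simp add: M_def N_def fg(4))
  have MN: "M (N x) = x" if "x \<in> sum_two_plane" for x
    using x0(1) that by (simp add: M_def N_def sum_two_plane_def fg(5) sum_subtractf)
  have N_eq: "N x = - g x0 + g x" for x by (simp add: N_def linear_diff[OF fg(2)])
  have N_image: "N ` S = (\<lambda>y. - g x0 + y) ` g ` S" for S by (simp add: image_image N_eq)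
  define h where "h l y = slack A l (M y)" for l y
  define w where "w a = N (edge_point A a)" for a
  define P where "P = tight_set UNIV h {}"
  define \<phi> where "\<phi> F = convex hull (w ` {a\<in>ordered_edges. edge_point unit_reciprocal a \<in> F})" for F
  have h_eq: "h l y = slack A l (f y) + slack A l x0" for l y
    by (simp add: h_def M_def linear_add[OF linear_slack])
  have lin: "linear (\<lambda>y. slack A l (f y))" for l
    using linear_compose[OF fg(1) linear_slack] by (simp add: o_def)
  have "slack A l (f ((1 - t) *\<^sub>R x + t *\<^sub>R y))
      = (1 - t) * slack A l (f x) + t * slack A l (f y)" for l t x y
    using affine_map_linear[OF lin, of l] by (simp add: affine_map_def)
  then have h: "affine_map (h l)" for l
    unfolding affine_map_def h_eq by (simp add: algebra_simps del: scaleR_left_diff_distrib)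
  have "P = N ` rectified A"
  proof (intro equalityI subsetI)
    fix y assume "y \<in> P"
    then have "M y \<in> rectified A"
      using M_plane by (simp add: P_def rectified_def tight_set_def h_def)
    then show "y \<in> N ` rectified A" using NM by (metis imageI)
  next
    fix y assume "y \<in> N ` rectified A"
    then show "y \<in> P" using MN by (auto simp: P_def rectified_def tight_set_def h_def)
  qed
  also have "\<dots> = convex hull (N ` edge_point A ` ordered_edges)"
    unfolding rectified_eq_hull[OF A] N_image
    by (simp only: convex_hull_translation convex_hull_linear_image[OF fg(2)])
  also have "\<dots> = convex hull (w ` ordered_edges)"
    by (simp add: image_image w_def)
  finally have P: "P = convex hull (w ` ordered_edges)" .
  have "polytope P"
    unfolding P polytope_def by (intro exI[of _ "w ` ordered_edges"]) simp
  moreover have "aff_dim P = int DIM('a)"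
  proof -
    \<comment> \<open>All inequalities are strict at the origin, so \<open>P\<close> has nonempty
      interior.\<close>
    have "open (\<Inter>l. {y. 0 < h l y})"
    proof (intro open_INT ballI open_Collect_less continuous_intros)
      have "continuous_on UNIV (\<lambda>y. slack A l (f y))" for l
        using lin linear_continuous_on by (metis linear_conv_bounded_linear)
      then show "continuous_on UNIV (h l)" for l
        unfolding h_eq by (intro continuous_intros)
    qed simp
    moreover have "0 \<in> (\<Inter>l. {y. 0 < h l y})"
      using x0(2) by (simp add: h_eq linear_0 fg(1) linear_slack)
    moreover have "(\<Inter>l. {y. 0 < h l y}) \<subseteq> P"
      by (auto simp: P_def tight_set_def less_imp_le)
    ultimately have "interior P \<noteq> {}" using interiorI by blast
    then show ?thesis by (rule aff_dim_nonempty_interior)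
  qed
  moreover have "face_lattice_iso \<phi> (hypersimplex 2) P"
    unfolding hypersimplex_two rectified_def P_def \<phi>_def
  proof (rule face_lattice_iso_of_incidence)
    show "tight_set sum_two_plane (slack unit_reciprocal) {} =
        convex hull (edge_point unit_reciprocal ` ordered_edges)"
      using rectified_eq_hull[OF reciprocal_unit] by (simp add: rectified_def)
    show "tight_set UNIV h {} = convex hull (w ` ordered_edges)"
      using P by (simp add: P_def)
    fix l :: "'n + 'n" and a :: "'n \<times> 'n" assume a: "a \<in> ordered_edges"
    have "edge_point A a \<in> sum_two_plane"
      using edge_point_rectified[OF A a] by (simp add: rectified_def tight_set_def)
    then show "slack unit_reciprocal l (edge_point unit_reciprocal a) = 0 \<longleftrightarrow> h l (w a) = 0"
      unfolding h_def w_def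
      by (simp add: MN slack_edge_point(2)[OF A a] slack_edge_point(2)[OF reciprocal_unit a])
  qed (simp_all add: affine_sum_two_plane affine_map_slack h)
  ultimately have "combinatorial_hypersimplex 2 P \<phi>"
    by (simp add: combinatorial_hypersimplex_def dim)
  moreover have "projectively_concurrent (\<lambda>i. affine hull (\<phi> (G_face 2 i)))"
    unfolding projectively_concurrent_def
  proof (intro disjI2 exI[of _ "g p"] conjI allI ballI)
    show "g p \<noteq> 0" using fg(5)[OF p(3)] p(2) linear_0[OF fg(1)] by auto
    fix i x t
    assume x: "x \<in> affine hull (\<phi> (G_face 2 i))"
    \<comment> \<open>These are the coefficients of \<open>kernel_vector_as_combination\<close>.
      They sum to zero because the entries of \<open>p\<close> other than \<open>p $ i\<close> sum
      to \<open>- p $ i\<close>, while weighted by row \<open>i\<close> they sum to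
      \<open>p $ i\<close>.\<close>
    let ?c = "\<lambda>j. p $ j * (1 + A $ i $ j) / 2"
    have "(\<Sum>j\<in>UNIV - {i}. p $ j) = - p $ i" "(\<Sum>j\<in>UNIV - {i}. A $ i $ j * p $ j) = p $ i"
      using p(3) matvec_split[OF A, of p i] p(1) by (simp_all add: sum.remove[of UNIV i])
    then have "(\<Sum>j\<in>UNIV - {i}. p $ j * (1 + A $ i $ j)) = 0"
      by (simp add: distrib_left sum.distrib mult.commute)
    then have c: "sum ?c (UNIV - {i}) = 0"
      by (simp flip: sum_divide_distrib)
    \<comment> \<open>The translation by \<open>g x0\<close> drops out since the coefficients sum to
      zero.\<close>
    have "(\<Sum>j\<in>UNIV - {i}. ?c j *\<^sub>R w (i, j))
        = (\<Sum>j\<in>UNIV - {i}. ?c j *\<^sub>R g (edge_point A (i, j))) - sum ?c (UNIV - {i}) *\<^sub>R g x0"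
      unfolding w_def N_eq scaleR_sum_left by (simp add: scaleR_diff_right sum_subtractf)
    also have "\<dots> = g (\<Sum>j\<in>UNIV - {i}. ?c j *\<^sub>R edge_point A (i, j))"
      unfolding c by (simp add: linear_sum[OF fg(2)] linear_scale[OF fg(2)])
    also have "\<dots> = g p"
      using kernel_vector_as_combination[OF A p(1), of i] by simp
    finally have gp: "g p = (\<Sum>j\<in>UNIV - {i}. ?c j *\<^sub>R w (i, j))" by simp
    have tgp: "t *\<^sub>R g p = (\<Sum>j\<in>UNIV - {i}. (t * ?c j) *\<^sub>R w (i, j))"
      unfolding gp by (simp only: scaleR_sum_right scaleR_scaleR)
    show "x + t *\<^sub>R g p \<in> affine hull (\<phi> (G_face 2 i))"
      unfolding tgp
    proof (rule affine_add_direction[OF affine_affine_hull x])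
      show "w (i, j) \<in> affine hull (\<phi> (G_face 2 i))" if "j \<in> UNIV - {i}" for j
        using that edge_point_in_G_face[of i j] unfolding \<phi>_def affine_hull_convex_hull
        by (intro hull_inc imageI) (auto simp: ordered_edges_def)
      show "(\<Sum>j\<in>UNIV - {i}. t * ?c j) = 0"
        using c by (simp only: mult_zero_right flip: sum_distrib_left)
    qed
  qed
  ultimately show ?thesis unfolding G_generic_def by blast
qed

section \<open>A singular circulant matrix of order six\<close>

text \<open>
  Applied to the alternating vector, the circulant matrix has the eigenvalue
  \<open>-1 - 1 + c - 1 + c\<^sup>-\<^sup>1 - 1\<close> when its first row is \<open>(-1, 1, c, 1, c\<^sup>-\<^sup>1, 1)\<close>. It vanishes iff
  \<open>c + c\<^sup>-\<^sup>1 = 4\<close>, that is \<open>c = 2 \<plusminus> \<surd>3\<close>.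
\<close>

definition circulant :: "int \<Rightarrow> real" where
  "circulant r =
     (if r = 0 then -1 else if r = 2 then 2 + sqrt 3 else if r = 4 then 2 - sqrt 3 else 1)"

lemma circulant_pos:
  assumes "r \<noteq> 0"
  shows "0 < circulant r"
proof -
  have "sqrt 3 < 2" by (rule real_less_lsqrt) auto
  then show ?thesis using assms by (simp add: circulant_def add_pos_pos)
qed

text \<open>Negation swaps the residues 2 and 4, whose entries are inverse to each other; the other
  nonzero residues carry 1.\<close>

lemma circulant_inverse:
  assumes "r mod 6 \<noteq> 0"
  shows "circulant (r mod 6) * circulant ((- r) mod 6) = 1"
proof -
  have "r mod 6 \<in> {1, 2, 3, 4, 5}"
    using assms pos_mod_bound[of 6 r] pos_mod_sign[of 6 r] by auto
  moreover have "(- r) mod 6 = 6 - r mod 6"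
    using assms by (simp add: zmod_zminus1_eq_if)
  moreover have "(2 + sqrt 3) * (2 - sqrt 3) = 1" by (simp add: algebra_simps)
  ultimately show ?thesis
    by (elim insertE emptyE) (simp_all add: circulant_def mult.commute)
qed

theorem proposition5p2:
  "\<exists>(P :: (real ^ 5) set) (\<phi> :: (real ^ 6) set \<Rightarrow> (real ^ 5) set).
     combinatorial_hypersimplex 2 P \<phi> \<and> \<not> G_generic 2 \<phi>"
proof -
  \<comment> \<open>A numbering of the index type, so that circulant offsets can be computed in the
    integers modulo 6.\<close>
  obtain q :: "6 \<Rightarrow> nat" where q: "bij_betw q UNIV {0..<6}"
    using ex_bij_betw_finite_nat[of "UNIV :: 6 set"] by auto
  define A :: "real ^ 6 ^ 6" where "A = (\<chi> i j. circulant ((int (q j) - int (q i)) mod 6))"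
  define p :: "real ^ 6" where "p = (\<chi> i. (-1) ^ q i)"
  \<comment> \<open>The barycentre of the simplex. Each row of \<open>A\<close> sums to 6, so every
    row slack there is 2.\<close>
  define x0 :: "real ^ 6" where "x0 = (\<chi> i. 1 / 3)"
  have q6: "q i \<in> {0, 1, 2, 3, 4, 5}" for i
    using bij_betwE[OF q] by (auto simp: atLeast0_lessThan_Suc numeral_eq_Suc)
  have q_inj: "q i = q j \<longleftrightarrow> i = j" for i j
    using bij_betw_imp_inj_on[OF q] by (auto simp: inj_on_def)
  have sum_q: "(\<Sum>j\<in>UNIV. F (q j)) = F 0 + F 1 + F 2 + F 3 + F 4 + F 5" for F :: "nat \<Rightarrow> real"
    using sum.reindex_bij_betw[OF q, of F] by (simp add: numeral_eq_Suc)
  have A: "reciprocal A"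
    unfolding reciprocal_def
  proof (intro conjI allI impI)
    show "A $ i $ i = -1" for i by (simp add: A_def circulant_def)
    fix i j :: 6 assume "i \<noteq> j"
    then have "q i \<noteq> q j" by (simp add: q_inj)
    then have ij: "(int (q j) - int (q i)) mod 6 \<noteq> 0"
      using q6[of i] q6[of j] by (elim insertE emptyE) simp_all
    then show "0 < A $ i $ j" by (simp add: A_def circulant_pos)
    show "A $ i $ j * A $ j $ i = 1"
      using circulant_inverse[of "int (q j) - int (q i)"] ij by (simp add: A_def)
  qed
  define c where "c m k = circulant ((int m - int k) mod 6)" for m k
  have row: "(A *v (\<chi> j. v (q j))) $ i = c 0 (q i) * v 0 + c 1 (q i) * v 1 + c 2 (q i) * v 2
      + c 3 (q i) * v 3 + c 4 (q i) * v 4 + c 5 (q i) * v 5" for v i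
    using sum_q[of "\<lambda>m. c m (q i) * v m"] by (simp add: matvec_component A_def c_def)
  show ?thesis
  proof (rule nongeneric_of_kernel_vector[OF A])
    show "x0 \<in> sum_two_plane" by (simp add: sum_two_plane_def x0_def)
    show "0 < slack A l x0" for l
    proof (cases l)
      case (Inr i)
      have "0 < (A *v x0) $ i"
        unfolding x0_def row[of "\<lambda>_. 1 / 3"] using q6[of i]
        by (elim insertE emptyE) (simp_all add: c_def circulant_def add_divide_distrib diff_divide_distrib)
      then show ?thesis using Inr by (simp add: slack_def)
    qed (simp add: slack_def x0_def)
    have "(A *v p) $ i = 0" for i
      unfolding p_def row[of "\<lambda>m. (-1) ^ m"] using q6[of i]
        by (elim insertE emptyE) (simp_all add: c_def circulant_def)
    then show "A *v p = 0" by (simp add: vec_eq_iff)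
    show "p \<noteq> 0" by (simp add: p_def vec_eq_iff)
    show "(\<Sum>i\<in>UNIV. p $ i) = 0" by (simp add: p_def sum_q[of "\<lambda>m. (-1) ^ m"])
  qed simp
qed

end
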